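(* Let $\lambda>0$, $c>0$, $p,q\ge 0$ with $p+q\le 1$, and let $(X(t),Y(t))$ be the planar random motion defined in the context. Let $S_{ct}=\{(x,y)\in\mathbb{R}^2: |x+y|\le ct,\ |x-y|\le ct\}$ and let $Q_{ct}=\{(x,y)\in S_{ct}: x=0\ \text{or}\ y=0\}$. Then for every $t>0$ $$\mathbb{P}\big((X(t),Y(t))\in Q_{ct}\big)=e^{-\lambda(p+q)t}.$$
   Context: Model. Let $d_j=(\cos(\pi j/2),\sin(\pi j/2))$, with index $j$ taken modulo 4. Let $N(t)$ be a homogeneous Poisson process of rate $\lambda$. The direction process $D(t)$ takes values in $\{d_0,d_1,d_2,d_3\}$; $D(0)$ is uniformly distributed and independent of $N$; $D$ is constant between Poisson events; at each Poisson event, independently of everything else, $D$ jumps from its current value $d_j$ to $d_{j+1}$ with probability $p$ (counterclockwise turn), to $d_{j-1}$ with probability $q$ (clockwise turn), and to $d_{j+2}$ with probability $1-p-q$ (reflection). The motion starts at the origin and has speed $c$: $(X(t),Y(t))=c\int_0^t D(\tau)\,d\tau$. *)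

theory Defs
  imports "HOL-Probability.Probability"
begin

text \<open>
  A homogeneous Poisson process: a counting process with right-continuous paths and independent,
  stationary, Poisson distributed increments. Only times \<open>t \<ge> 0\<close> are constrained. The path
  properties hold for every outcome, as is usual for counting processes; since \<open>M\<close> need not be
  complete, this is what makes path functionals such as the position below measurable.
  Truncated subtraction on \<^typ>\<open>nat\<close> is harmless because paths are nondecreasing.
\<close>

locale poisson_process = prob_space M for M :: "'a measure" +
  fixes rate :: real and N :: "real \<Rightarrow> 'a \<Rightarrow> nat"
  assumes measurable_N: "\<And>t. 0 \<le> t \<Longrightarrow> N t \<in> measurable M (count_space UNIV)"
    and N_zero: "\<And>\<omega>. \<omega> \<in> space M \<Longrightarrow> N 0 \<omega> = 0"
    and N_mono: "\<And>\<omega> s t. \<omega> \<in> space M \<Longrightarrow> 0 \<le> s \<Longrightarrow> s \<le> t \<Longrightarrow> N s \<omega> \<le> N t \<omega>"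
    and N_right_continuous:
      "\<And>\<omega> t. \<omega> \<in> space M \<Longrightarrow> 0 \<le> t \<Longrightarrow> continuous (at_right t) (\<lambda>s. N s \<omega>)"
    and N_increments_indep:
      "\<And>(ts :: nat \<Rightarrow> real) n. 0 \<le> ts 0 \<Longrightarrow> (\<And>i. i < n \<Longrightarrow> ts i \<le> ts (Suc i)) \<Longrightarrow>
        indep_vars (\<lambda>_. count_space UNIV) (\<lambda>i \<omega>. N (ts (Suc i)) \<omega> - N (ts i) \<omega>) {..<n}"
    and N_increments_poisson:
      "\<And>s t. 0 \<le> s \<Longrightarrow> s < t \<Longrightarrow>
        distr M (count_space UNIV) (\<lambda>\<omega>. N t \<omega> - N s \<omega>) = measure_pmf (poisson_pmf (rate * (t - s)))"

text \<open>The direction \<open>d\<^sub>j\<close>; reduction of the index modulo 4 is automatic by periodicity.\<close>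

definition dir :: "int \<Rightarrow> real \<times> real" where
  "dir j = (cos (pi * of_int j / 2), sin (pi * of_int j / 2))"

datatype source = Clock | Start | Turn nat

text \<open>
  \<open>start\<close> is the index of the initial direction and \<open>turn k\<close> is the change of index at the
  \<open>(k + 1)\<close>-st Poisson event: \<open>1\<close> counterclockwise, \<open>-1\<close> clockwise, \<open>2\<close> reflection.
  The last assumption says that the whole process \<open>N\<close>, the initial direction and all the turns
  are mutually independent.
\<close>

locale orthogonal_motion = poisson_process M rate N
  for M :: "'a measure" and rate :: real and N :: "real \<Rightarrow> 'a \<Rightarrow> nat" +
  fixes p q :: real and start :: "'a \<Rightarrow> int" and turn :: "nat \<Rightarrow> 'a \<Rightarrow> int"
  assumes measurable_start: "start \<in> measurable M (count_space UNIV)"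
    and measurable_turn: "\<And>k. turn k \<in> measurable M (count_space UNIV)"
    and start_uniform: "\<And>j. j \<in> {0, 1, 2, 3} \<Longrightarrow> prob {\<omega> \<in> space M. start \<omega> = j} = 1 / 4"
    and turn_counterclockwise: "\<And>k. prob {\<omega> \<in> space M. turn k \<omega> = 1} = p"
    and turn_clockwise: "\<And>k. prob {\<omega> \<in> space M. turn k \<omega> = - 1} = q"
    and turn_reflection: "\<And>k. prob {\<omega> \<in> space M. turn k \<omega> = 2} = 1 - p - q"
    and sources_indep:
      "indep_sets
        (\<lambda>s. case s of
            Clock \<Rightarrow> sigma_sets (space M) {N t -` A \<inter> space M | t A. 0 \<le> t}
          | Start \<Rightarrow> {start -` A \<inter> space M | A. True}
          | Turn k \<Rightarrow> {turn k -` A \<inter> space M | A. True}) UNIV"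

definition direction ::
  "(real \<Rightarrow> 'a \<Rightarrow> nat) \<Rightarrow> ('a \<Rightarrow> int) \<Rightarrow> (nat \<Rightarrow> 'a \<Rightarrow> int) \<Rightarrow> real \<Rightarrow> 'a \<Rightarrow> real \<times> real" where
  "direction N start turn t \<omega> = dir (start \<omega> + (\<Sum>k<N t \<omega>. turn k \<omega>))"

definition position ::
  "real \<Rightarrow> (real \<Rightarrow> 'a \<Rightarrow> nat) \<Rightarrow> ('a \<Rightarrow> int) \<Rightarrow> (nat \<Rightarrow> 'a \<Rightarrow> int) \<Rightarrow> real \<Rightarrow> 'a \<Rightarrow> real \<times> real" where
  "position c N start turn t \<omega> = c *\<^sub>R integral {0..t} (\<lambda>\<tau>. direction N start turn \<tau> \<omega>)"

definition S_region :: "real \<Rightarrow> (real \<times> real) set" where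
  "S_region r = {(x, y). \<bar>x + y\<bar> \<le> r \<and> \<bar>x - y\<bar> \<le> r}"

definition Q_region :: "real \<Rightarrow> (real \<times> real) set" where
  "Q_region r = {(x, y) \<in> S_region r. x = 0 \<or> y = 0}"

end

theory Submission
  imports Defs
begin

text \<open>
  If all turns up to time \<open>t\<close> are reflections, the motion stays on one coordinate axis; this has
  probability \<open>E (1 - p - q)\<^bsup>N t\<^esup> = exp (- rate * (p + q) * t)\<close>. Otherwise some turn before \<open>t\<close> is
  orthogonal, and both coordinates are almost surely nonzero. Fixing the finitely many headings
  taken, a coordinate is \<open>\<integral> f (N \<tau>) d\<tau>\<close> over \<open>[0, t]\<close> with a deterministic \<open>f\<close> such that
  \<open>f k \<noteq> f (k + 1)\<close> for some \<open>k < n = N t\<close>. Cut \<open>[0, t]\<close> into \<open>m\<close> cells. Except with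
  probability \<open>O(1 / m)\<close> each cell contains at most one jump, and the Riemann sum differs from the
  integral by \<open>O(n t / m)\<close>. If the integral vanishes, then once the cells of the other jumps are
  known, only a bounded number of cells remain possible for the \<open>(k + 1)\<close>-st jump, because moving
  it by one cell changes the sum by \<open>f (k + 1) - f k\<close>. Hence \<open>O(m\<^bsup>n - 1\<^esup>)\<close> of the possible jump
  patterns survive, each of probability \<open>O(m\<^bsup>- n\<^esup>)\<close>.
\<close>

section \<open>Riemann sums along a monotone integer-valued clock\<close>

text \<open>A monotone path is Lebesgue measurable and \<open>f\<close> acts on a discrete value, so
  the composite is measurable; being bounded, it is integrable on a compact interval.\<close>

lemma monotone_clock_integrable:
  fixes \<nu> :: "real \<Rightarrow> nat" and f :: "nat \<Rightarrow> 'b::euclidean_space"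
  assumes mono: "mono_on {a..b} \<nu>" and bound: "\<And>k. norm (f k) \<le> K"
  shows "(\<lambda>\<tau>. f (\<nu> \<tau>)) integrable_on {a..b}"
proof (rule measurable_bounded_by_integrable_imp_integrable)
  have "mono_on {a..b} (\<lambda>\<tau>. real (\<nu> \<tau>))"
    using mono by (auto simp: mono_on_def)
  then have "(\<lambda>\<tau>. real (\<nu> \<tau>)) \<in> borel_measurable (lebesgue_on {a..b})"
    using measurable_compose[OF measurable_restrict_space3[of "\<lambda>x::real. x" lebesgue borel "{a..b}" "{a..b}"]]
      borel_measurable_mono_on_fnc measurable_completion[OF measurable_ident_sets[OF sets_lborel]]
    by (auto simp: id_def)
  \<comment> \<open>The floor returns the clock value unchanged, but as a measurable map into the
    discrete integers; \<open>nat\<close> then undoes the conversion.\<close>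
  then have "(\<lambda>\<tau>. \<lfloor>real (\<nu> \<tau>)\<rfloor>) \<in> measurable (lebesgue_on {a..b}) (count_space UNIV)"
    by measurable
  then have "(\<lambda>\<tau>. (f \<circ> nat) \<lfloor>real (\<nu> \<tau>)\<rfloor>) \<in> borel_measurable (lebesgue_on {a..b})"
    by (rule measurable_compose) simp
  then show "(\<lambda>\<tau>. f (\<nu> \<tau>)) \<in> borel_measurable (lebesgue_on {a..b})"
    by simp
qed (use bound in auto)

text \<open>Without a jump the integrand is constant and there is no error. Otherwise the integer
  increment is at least 1, so the crude bound \<open>2 * K * (b - a)\<close> may be multiplied by
  it.\<close>

lemma monotone_clock_cell_error:
  fixes \<nu> :: "real \<Rightarrow> nat" and f :: "nat \<Rightarrow> 'b::euclidean_space"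
  assumes mono: "mono_on {a..b} \<nu>" and bound: "\<And>k. norm (f k) \<le> K" and "a \<le> b"
  shows "norm (integral {a..b} (\<lambda>\<tau>. f (\<nu> \<tau>)) - (b - a) *\<^sub>R f (\<nu> a))
    \<le> 2 * K * (b - a) * (real (\<nu> b) - real (\<nu> a))"
proof -
  have ab: "\<nu> a \<le> \<nu> b" using mono \<open>a \<le> b\<close> by (auto simp: mono_on_def)
  have K: "0 \<le> K" using bound[of 0] norm_ge_zero order_trans by blast
  have int: "(\<lambda>\<tau>. f (\<nu> \<tau>)) integrable_on {a..b}"
    using mono bound by (rule monotone_clock_integrable)
  have eq: "integral {a..b} (\<lambda>\<tau>. f (\<nu> \<tau>)) - (b - a) *\<^sub>R f (\<nu> a)
      = integral {a..b} (\<lambda>\<tau>. f (\<nu> \<tau>) - f (\<nu> a))"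
    using int \<open>a \<le> b\<close> by (subst integral_diff) auto
  show ?thesis
  proof (cases "\<nu> a = \<nu> b")
    case True
    have "\<nu> \<tau> = \<nu> a" if "\<tau> \<in> {a..b}" for \<tau>
      using mono_onD[OF mono, of a \<tau>] mono_onD[OF mono, of \<tau> b] that True by auto
    then have "integral {a..b} (\<lambda>\<tau>. f (\<nu> \<tau>) - f (\<nu> a)) = integral {a..b} (\<lambda>\<tau>. 0)"
      by (intro Henstock_Kurzweil_Integration.integral_cong) (metis diff_self)
    then show ?thesis unfolding eq using True by simp
  next
    case False
    have "norm (integral {a..b} (\<lambda>\<tau>. f (\<nu> \<tau>) - f (\<nu> a))) \<le> integral {a..b} (\<lambda>\<tau>. 2 * K)"
    proof (rule Henstock_Kurzweil_Integration.integral_norm_bound_integral)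
      show "(\<lambda>\<tau>. f (\<nu> \<tau>) - f (\<nu> a)) integrable_on {a..b}"
        using int by (intro integrable_diff) auto
      show "norm (f (\<nu> \<tau>) - f (\<nu> a)) \<le> 2 * K" for \<tau>
        using norm_triangle_ineq4[of "f (\<nu> \<tau>)" "f (\<nu> a)"] bound[of "\<nu> \<tau>"] bound[of "\<nu> a"]
        by linarith
    qed auto
    also have "\<dots> = 2 * K * (b - a) * 1" using \<open>a \<le> b\<close> by simp
    also have "\<dots> \<le> 2 * K * (b - a) * (real (\<nu> b) - real (\<nu> a))"
      using False ab K \<open>a \<le> b\<close> by (intro mult_left_mono) auto
    finally show ?thesis unfolding eq .
  qed
qed

text \<open>The cell errors telescope: the bound scales with the total number of jumps, not with the
  number of cells, so for a fixed path and horizon it vanishes with the mesh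
  \<open>h\<close>.\<close>

lemma monotone_clock_riemann_error:
  fixes \<nu> :: "real \<Rightarrow> nat" and f :: "nat \<Rightarrow> 'b::euclidean_space"
  assumes mono: "mono_on {0..} \<nu>" and bound: "\<And>k. norm (f k) \<le> K" and "0 \<le> h"
  shows "norm (integral {0..real m * h} (\<lambda>\<tau>. f (\<nu> \<tau>)) - h *\<^sub>R (\<Sum>i<m. f (\<nu> (real i * h))))
    \<le> 2 * K * h * (real (\<nu> (real m * h)) - real (\<nu> 0))"
proof (induction m)
  case (Suc m)
  let ?a = "real m * h" and ?b = "real (Suc m) * h"
  have le: "0 \<le> ?a" "?a \<le> ?b" "?b - ?a = h"
    using \<open>0 \<le> h\<close> by (auto simp: algebra_simps)
  have "(\<lambda>\<tau>. f (\<nu> \<tau>)) integrable_on {0..?b}"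
    by (rule monotone_clock_integrable[OF _ bound]) (rule mono_on_subset[OF mono], auto)
  then have split: "integral {0..?b} (\<lambda>\<tau>. f (\<nu> \<tau>))
      = integral {0..?a} (\<lambda>\<tau>. f (\<nu> \<tau>)) + integral {?a..?b} (\<lambda>\<tau>. f (\<nu> \<tau>))"
    using Henstock_Kurzweil_Integration.integral_combine[of 0 ?a ?b "\<lambda>\<tau>. f (\<nu> \<tau>)"] le by simp
  have mono': "mono_on {?a..?b} \<nu>"
    using le by (intro mono_on_subset[OF mono]) auto
  have cell: "norm (integral {?a..?b} (\<lambda>\<tau>. f (\<nu> \<tau>)) - h *\<^sub>R f (\<nu> ?a))
      \<le> 2 * K * h * (real (\<nu> ?b) - real (\<nu> ?a))"
    using monotone_clock_cell_error[OF mono' bound le(2)] unfolding le(3) .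
  have "integral {0..?b} (\<lambda>\<tau>. f (\<nu> \<tau>)) - h *\<^sub>R (\<Sum>i<Suc m. f (\<nu> (real i * h)))
      = (integral {0..?a} (\<lambda>\<tau>. f (\<nu> \<tau>)) - h *\<^sub>R (\<Sum>i<m. f (\<nu> (real i * h))))
        + (integral {?a..?b} (\<lambda>\<tau>. f (\<nu> \<tau>)) - h *\<^sub>R f (\<nu> ?a))"
    unfolding split by (simp add: scaleR_add_right)
  also have "norm \<dots> \<le> 2 * K * h * (real (\<nu> ?a) - real (\<nu> 0)) 
      + 2 * K * h * (real (\<nu> ?b) - real (\<nu> ?a))"
    by (rule norm_triangle_mono[OF Suc.IH cell])
  also have "\<dots> = 2 * K * h * (real (\<nu> ?b) - real (\<nu> 0))"
    by (simp only: right_diff_distrib)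
  finally show ?case .
qed simp

section \<open>Counting jump patterns with a small Riemann sum\<close>

text \<open>The number of elements of \<open>J\<close> below \<open>i\<close> grows with
  \<open>i\<close> in steps of at most 1, so the first \<open>i\<close> where it exceeds
  \<open>k\<close> is the successor of the wanted element.\<close>

lemma nth_element_exists:
  fixes J :: "nat set"
  assumes "finite J" and "k < card J"
  obtains x where "x \<in> J" and "card (J \<inter> {..<x}) = k"
proof -
  define g where "g i = card (J \<inter> {..<i})" for i
  obtain m where m: "J \<subseteq> {..<m}" using \<open>finite J\<close> finite_nat_iff_bounded by blast
  then have "k < g m" using assms(2) by (simp add: g_def Int_absorb2)
  define y where "y = (LEAST i. k < g i)"
  have y: "k < g y" unfolding y_def using \<open>k < g m\<close> by (rule LeastI)
  then obtain x where x: "y = Suc x" by (cases y) (auto simp: g_def)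
  have gx: "g x \<le> k" using not_less_Least[of x "\<lambda>i. k < g i"] x y_def by auto
  have gs: "g (Suc x) = (if x \<in> J then Suc (g x) else g x)"
    unfolding g_def by (simp add: lessThan_Suc Int_insert_right)
  then have "x \<in> J" "g x = k" using y x gx by (auto split: if_splits)
  then show thesis using that by (auto simp: g_def)
qed

lemma card_subset_interval:
  fixes S :: "nat set" and D :: nat
  assumes "\<And>x y. x \<in> S \<Longrightarrow> y \<in> S \<Longrightarrow> x < y \<Longrightarrow> y - x \<le> D"
  shows "card S \<le> Suc D"
proof (cases "S = {}")
  case False
  define a where "a = (LEAST x. x \<in> S)"
  have a: "a \<in> S" "\<And>y. y \<in> S \<Longrightarrow> a \<le> y"
    using False unfolding a_def by (auto intro: LeastI Least_le)
  have "y \<le> a + D" if "y \<in> S" for y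
    using assms[OF a(1) that] a(2)[OF that] by (cases "a = y") auto
  then have "S \<subseteq> {a..a + D}" using a(2) by auto
  then have "card S \<le> card {a..a + D}" by (intro card_mono) auto
  then show ?thesis by simp
qed simp

text \<open>Here \<open>J\<close> is the set of cells containing a jump, and
  \<open>card (J \<inter> {..<i})\<close> is the clock value at the left end of cell
  \<open>i\<close>. Compared with all \<open>n\<close>-element patterns, the near-zero condition
  gains one power of \<open>m\<close>; \<open>L\<close> bounds the number of cells left for the jump
  of rank \<open>k\<close>.\<close>

lemma card_near_zero_configurations:
  fixes f :: "nat \<Rightarrow> real" and C :: real
  assumes k: "k < n" and ne: "f k \<noteq> f (Suc k)"
  defines "L \<equiv> Suc (nat \<lfloor>2 * C / \<bar>f (Suc k) - f k\<bar>\<rfloor>)"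
  shows "card {J. J \<subseteq> {..<m} \<and> card J = n \<and> \<bar>\<Sum>i<m. f (card (J \<inter> {..<i}))\<bar> \<le> C} \<le> L * m ^ (n - 1)"
    (is "card ?F \<le> _")
proof -
  define s where "s J = (\<Sum>i<m. f (card (J \<inter> {..<i})))" for J :: "nat set"
  define X where "X J = {x. x < m \<and> x \<notin> J \<and> card (J \<inter> {..<x}) = k \<and> \<bar>s (insert x J)\<bar> \<le> C}"
    for J
  define P where "P = {J. J \<subseteq> {..<m} \<and> card J = n - 1}"
  have finP: "finite P" unfolding P_def by (rule finite_subset[of _ "Pow {..<m}"]) auto
  have finX: "finite (X J)" for J unfolding X_def by (rule finite_subset[of _ "{..<m}"]) auto
  \<comment> \<open>removing the element of rank \<open>k\<close> maps the family to \<open>P\<close> with fibres of size at most \<open>L\<close>\<close>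
  have sub: "?F \<subseteq> (\<Union>J\<in>P. (\<lambda>x. insert x J) ` X J)"
  proof
    fix J assume J: "J \<in> ?F"
    then have fin: "finite J" using finite_subset by blast
    from J have "k < card J" using k by simp
    with fin obtain x where x: "x \<in> J" "card (J \<inter> {..<x}) = k" by (rule nth_element_exists)
    have "(J - {x}) \<inter> {..<x} = J \<inter> {..<x}" by auto
    then have "x \<in> X (J - {x})" using x J by (auto simp: X_def s_def insert_absorb)
    moreover have "J - {x} \<in> P" using J x fin by (auto simp: P_def)
    moreover have "J = insert x (J - {x})" using x by auto
    ultimately show "J \<in> (\<Union>J\<in>P. (\<lambda>x. insert x J) ` X J)" by blast
  qed
  have cX: "card (X J) \<le> L" if "J \<in> P" for J
    unfolding L_def
  proof (rule card_subset_interval)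
    have fin: "finite J" using that finite_subset unfolding P_def by blast
    fix x y assume x: "x \<in> X J" and y: "y \<in> X J" and xy: "x < y"
    have count: "card (insert z J \<inter> {..<i}) = (if z < i then Suc (card (J \<inter> {..<i})) else card (J \<inter> {..<i}))"
      if "z \<notin> J" for z i
      using that fin by (auto simp: Int_insert_left)
    \<comment> \<open>Both \<open>x\<close> and \<open>y\<close> have rank \<open>k\<close> relative
      to the remaining jumps \<open>J\<close>, so none of these lies between them.\<close>
    have k_between: "card (J \<inter> {..<i}) = k" if "x < i" "i \<le> y" for i
    proof -
      have "card (J \<inter> {..<x}) \<le> card (J \<inter> {..<i})" "card (J \<inter> {..<i}) \<le> card (J \<inter> {..<y})"
        using that fin by (intro card_mono; auto)+
      then show ?thesis using x y by (simp add: X_def)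
    qed
    have "s (insert x J) - s (insert y J)
        = (\<Sum>i<m. f (card (insert x J \<inter> {..<i})) - f (card (insert y J \<inter> {..<i})))"
      by (simp add: s_def sum_subtractf)
    \<comment> \<open>Outside \<open>{x<..y}\<close> the two patterns give equal counts; inside, the
      moved jump has been counted only if it sits in cell \<open>x\<close>. The index
      \<open>x\<close> is excluded because a jump in cell \<open>x\<close> first shows at the left
      end of the next cell.\<close>
    also have "\<dots> = (\<Sum>i<m. if i \<in> {x<..y} then f (Suc k) - f k else 0)"
      using x y xy k_between by (intro sum.cong refl) (auto simp: count X_def)
    also have "\<dots> = (\<Sum>i\<in>{..<m} \<inter> {x<..y}. f (Suc k) - f k)"
      by (subst sum.inter_restrict) auto
    also have "{..<m} \<inter> {x<..y} = {x<..y}" using y by (auto simp: X_def)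
    finally have "\<bar>s (insert x J) - s (insert y J)\<bar> = real (y - x) * \<bar>f (Suc k) - f k\<bar>"
      by (simp add: abs_mult)
    moreover have "\<bar>s (insert x J) - s (insert y J)\<bar> \<le> 2 * C"
      using x y by (auto simp: X_def)
    ultimately have "real (y - x) \<le> 2 * C / \<bar>f (Suc k) - f k\<bar>"
      using ne by (simp add: field_simps)
    then show "y - x \<le> nat \<lfloor>2 * C / \<bar>f (Suc k) - f k\<bar>\<rfloor>" by linarith
  qed
  have cP: "card P \<le> m ^ (n - 1)"
  proof (cases "n - 1 \<le> m")
    case True
    have "card P = m choose (n - 1)" unfolding P_def using n_subsets[of "{..<m}" "n - 1"] by simp
    also have "\<dots> \<le> m ^ (n - 1)" using True by (rule binomial_le_pow)
    finally show ?thesis .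
  next
    case False
    have "J \<notin> P" for J
      using card_mono[of "{..<m}" J] False by (auto simp: P_def)
    then have "P = {}" by blast
    then show ?thesis by simp
  qed
  have "card ?F \<le> card (\<Union>J\<in>P. (\<lambda>x. insert x J) ` X J)"
    by (rule card_mono[OF _ sub]) (intro finite_UN_I finite_imageI finP finX)
  also have "\<dots> \<le> (\<Sum>J\<in>P. card ((\<lambda>x. insert x J) ` X J))" by (rule card_UN_le[OF finP])
  also have "\<dots> \<le> (\<Sum>J\<in>P. L)"
    by (rule sum_mono) (rule order_trans[OF card_image_le[OF finX] cX])
  also have "\<dots> \<le> L * m ^ (n - 1)" using cP by simp
  finally show ?thesis .
qed

section \<open>Poisson increments over small cells\<close>

text \<open>The left side is the probability that a Poisson variable of mean \<open>a\<close> is at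
  least 2; multiply \<open>1 - a \<le> exp (- a)\<close> by \<open>1 + a\<close>. The quadratic
  order keeps the sum over \<open>m\<close> cells of width \<open>t / m\<close> at order
  \<open>1 / m\<close>.\<close>

lemma poisson_tail_le_square:
  fixes a :: real
  assumes "0 \<le> a"
  shows "1 - exp (- a) - a * exp (- a) \<le> a\<^sup>2"
proof -
  have "(1 - a) * (1 + a) \<le> exp (- a) * (1 + a)"
    using exp_ge_add_one_self[of "- a"] assms by (intro mult_right_mono) auto
  then show ?thesis by (simp add: algebra_simps power2_eq_square)
qed

context poisson_process
begin

lemma mono_on_path:
  assumes "\<omega> \<in> space M"
  shows "mono_on {0..} (\<lambda>s. N s \<omega>)"
  using N_mono[OF assms] by (auto simp: mono_on_def)

lemma measurable_increment:
  assumes "0 \<le> s" "0 \<le> u"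
  shows "(\<lambda>\<omega>. N u \<omega> - N s \<omega>) \<in> measurable M (count_space UNIV)"
proof -
  note [measurable] = measurable_N[OF assms(1)] measurable_N[OF assms(2)]
  show ?thesis by measurable
qed

lemma prob_increment:
  assumes "0 < rate" "0 \<le> s" "s < u"
  shows "prob {\<omega> \<in> space M. N u \<omega> - N s \<omega> = k}
    = (rate * (u - s)) ^ k / fact k * exp (- (rate * (u - s)))"
proof -
  have "prob {\<omega> \<in> space M. N u \<omega> - N s \<omega> = k}
      = measure (distr M (count_space UNIV) (\<lambda>\<omega>. N u \<omega> - N s \<omega>)) {k}"
    using measurable_increment[of s u] assms
    by (subst measure_distr) (auto intro!: arg_cong[where f = prob])
  also have "\<dots> = pmf (poisson_pmf (rate * (u - s))) k"
    using assms by (simp add: N_increments_poisson pmf.rep_eq)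
  finally show ?thesis using assms by simp
qed

lemma prob_N:
  assumes "0 < rate" "0 < t"
  shows "prob {\<omega> \<in> space M. N t \<omega> = k} = (rate * t) ^ k / fact k * exp (- (rate * t))"
proof -
  have "{\<omega> \<in> space M. N t \<omega> = k} = {\<omega> \<in> space M. N t \<omega> - N 0 \<omega> = k}"
    using N_zero by auto
  then show ?thesis using prob_increment[of 0 t k] assms by simp
qed

lemma prob_increment_ge_2:
  assumes "0 < rate" "0 \<le> s" "s < u"
  shows "prob {\<omega> \<in> space M. 2 \<le> N u \<omega> - N s \<omega>} \<le> (rate * (u - s))\<^sup>2"
proof -
  let ?D = "\<lambda>\<omega>. N u \<omega> - N s \<omega>"
  have [measurable]: "?D \<in> measurable M (count_space UNIV)"
    using measurable_increment[of s u] assms by simp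
  have E: "{\<omega> \<in> space M. ?D \<omega> = k} \<in> events" for k
    by measurable
  have "{\<omega> \<in> space M. 2 \<le> ?D \<omega>}
      = space M - ({\<omega> \<in> space M. ?D \<omega> = 0} \<union> {\<omega> \<in> space M. ?D \<omega> = 1})"
    by (auto simp del: diff_is_0_eq)
  also have "prob \<dots> = 1 - prob ({\<omega> \<in> space M. ?D \<omega> = 0} \<union> {\<omega> \<in> space M. ?D \<omega> = 1})"
    by (intro prob_compl sets.Un E)
  also have "prob ({\<omega> \<in> space M. ?D \<omega> = 0} \<union> {\<omega> \<in> space M. ?D \<omega> = 1})
      = prob {\<omega> \<in> space M. ?D \<omega> = 0} + prob {\<omega> \<in> space M. ?D \<omega> = 1}"
    by (intro finite_measure_Union E) auto
  also have "1 - \<dots> \<le> (rate * (u - s))\<^sup>2"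
    using poisson_tail_le_square[of "rate * (u - s)"] assms
    unfolding prob_increment[OF assms] by simp
  finally show ?thesis .
qed

lemma prob_increment_1:
  assumes "0 < rate" "0 \<le> s" "s < u"
  shows "prob {\<omega> \<in> space M. N u \<omega> - N s \<omega> = 1} \<le> rate * (u - s)"
  unfolding prob_increment[OF assms] using assms by (simp add: mult_left_le)

text \<open>Disjoint cells are independent; each cell of \<open>J\<close> contributes at most
  \<open>rate * h\<close>, and every empty cell is bounded by 1.\<close>

lemma prob_configuration:
  assumes "0 < rate" "0 < h" "0 < m" "J \<subseteq> {..<m}"
  shows "prob {\<omega> \<in> space M. \<forall>i<m. N (real (Suc i) * h) \<omega> - N (real i * h) \<omega> = of_bool (i \<in> J)}
    \<le> (rate * h) ^ card J"
proof -
  let ?X = "\<lambda>i \<omega>. N (real (Suc i) * h) \<omega> - N (real i * h) \<omega>"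
  have "indep_vars (\<lambda>_. count_space UNIV) ?X {..<m}"
    using N_increments_indep[of "\<lambda>i. real i * h" m] assms by simp
  then have "prob (\<Inter>i\<in>{..<m}. ?X i -` {of_bool (i \<in> J)} \<inter> space M)
      = (\<Prod>i\<in>{..<m}. prob (?X i -` {of_bool (i \<in> J)} \<inter> space M))"
    using assms by (intro indep_varsD) auto
  \<comment> \<open>Here \<open>0 < m\<close> matters: an intersection over no cells would be the
    whole type instead of \<open>space M\<close>.\<close>
  also have "(\<Inter>i\<in>{..<m}. ?X i -` {of_bool (i \<in> J)} \<inter> space M)
      = {\<omega> \<in> space M. \<forall>i<m. ?X i \<omega> = of_bool (i \<in> J)}"
    using assms by auto
  also have "(\<Prod>i\<in>{..<m}. prob (?X i -` {of_bool (i \<in> J)} \<inter> space M))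
      \<le> (\<Prod>i\<in>{..<m}. if i \<in> J then rate * h else 1)"
  proof (rule prod_mono, safe)
    fix i
    show "prob (?X i -` {of_bool (i \<in> J)} \<inter> space M) \<le> (if i \<in> J then rate * h else 1)"
    proof (cases "i \<in> J")
      case True
      have "?X i -` {1} \<inter> space M = {\<omega> \<in> space M. ?X i \<omega> = 1}" by auto
      then show ?thesis
        using True assms prob_increment_1[of "real i * h" "real (Suc i) * h"]
        by (simp add: algebra_simps)
    qed auto
  qed auto
  also have "\<dots> = (rate * h) ^ card J"
    using assms(4) by (subst prod.If_cases) (auto simp: Int_absorb1)
  finally show ?thesis .
qed

section \<open>Integrals along the clock: measurability and null events\<close>

text \<open>On every path the integral is the limit of its Riemann sums. Letting \<open>g\<close>
  depend on the outcome covers the random directions.\<close>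

lemma measurable_clock_integral:
  fixes g :: "nat \<Rightarrow> 'a \<Rightarrow> 'b::euclidean_space"
  assumes g: "\<And>k. g k \<in> borel_measurable M" and bound: "\<And>k \<omega>. norm (g k \<omega>) \<le> K" and t: "0 \<le> t"
  shows "(\<lambda>\<omega>. integral {0..t} (\<lambda>\<tau>. g (N \<tau> \<omega>) \<omega>)) \<in> borel_measurable M"
proof (rule borel_measurable_LIMSEQ_metric)
  \<comment> \<open>\<open>Suc m\<close> cells keep the mesh from dividing by zero; each sum
    involves finitely many clock values and is therefore measurable.\<close>
  define u where "u m \<omega> = (t / real (Suc m)) *\<^sub>R
    (\<Sum>i<Suc m. g (N (real i * (t / real (Suc m))) \<omega>) \<omega>)" for m \<omega>
  have "(\<lambda>\<omega>. g (N s \<omega>) \<omega>) \<in> borel_measurable M" if "0 \<le> s" for s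
    using g measurable_N[OF that] by (rule measurable_compose_countable)
  then show "u m \<in> borel_measurable M" for m
    unfolding u_def using t by (intro borel_measurable_scaleR borel_measurable_sum borel_measurable_const) simp
  fix \<omega> assume \<omega>: "\<omega> \<in> space M"
  let ?I = "integral {0..t} (\<lambda>\<tau>. g (N \<tau> \<omega>) \<omega>)"
  have "norm (u m \<omega> - ?I) \<le> (2 * K * t * real (N t \<omega>)) * inverse (real (Suc m))" for m
    using monotone_clock_riemann_error[OF mono_on_path[OF \<omega>], of "\<lambda>k. g k \<omega>" K "t / real (Suc m)" "Suc m"]
      bound t N_zero[OF \<omega>]
    by (simp add: u_def norm_minus_commute divide_inverse mult.assoc mult.commute mult.left_commute
        del: of_nat_Suc)
  moreover have "(\<lambda>m. (2 * K * t * real (N t \<omega>)) * inverse (real (Suc m))) \<longlonglongrightarrow> 0"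
    using tendsto_mult_right_zero LIMSEQ_inverse_real_of_nat by blast
  ultimately have "(\<lambda>m. u m \<omega> - ?I) \<longlonglongrightarrow> 0"
    by (intro Lim_null_comparison[of "\<lambda>m. u m \<omega> - ?I"] always_eventually) auto
  then show "(\<lambda>m. u m \<omega>) \<longlonglongrightarrow> ?I" by (rule LIM_zero_cancel)
qed

lemma configuration_count:
  assumes \<omega>: "\<omega> \<in> space M" and h: "0 \<le> h"
    and J: "\<And>i. i < m \<Longrightarrow> N (real (Suc i) * h) \<omega> - N (real i * h) \<omega> = of_bool (i \<in> J)"
    and "i \<le> m"
  shows "N (real i * h) \<omega> = card (J \<inter> {..<i})"
  using \<open>i \<le> m\<close>
proof (induction i)
  case 0
  then show ?case using N_zero[OF \<omega>] by simp
next
  case (Suc i)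
  \<comment> \<open>Monotonicity makes the truncated difference a true one, so the increment can be
    added back.\<close>
  have "N (real i * h) \<omega> \<le> N (real (Suc i) * h) \<omega>"
    using h by (intro N_mono[OF \<omega>] mult_right_mono) auto
  then have "N (real (Suc i) * h) \<omega> = N (real i * h) \<omega> + of_bool (i \<in> J)"
    using J[of i] Suc.prems by linarith
  also have "\<dots> = card (J \<inter> {..<Suc i})"
    using Suc by (simp add: lessThan_Suc Int_insert_right)
  finally show ?case .
qed

text \<open>A union bound: \<open>m\<close> cells, each with two jumps with probability at most
  \<open>(rate * t / m) ^ 2\<close>, and at most \<open>L * m ^ (n - 1)\<close> patterns of
  probability at most \<open>(rate * t / m) ^ n\<close>. Both totals are of order
  \<open>1 / m\<close>.\<close>

lemma clock_integral_zero_bound: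
  fixes f :: "nat \<Rightarrow> real"
  assumes rate: "0 < rate" and t: "0 < t" and bound: "\<And>i. \<bar>f i\<bar> \<le> K"
    and k: "k < n" and ne: "f k \<noteq> f (Suc k)" and m: "0 < m"
  defines "L \<equiv> Suc (nat \<lfloor>2 * (2 * K * real n) / \<bar>f (Suc k) - f k\<bar>\<rfloor>)"
  shows "prob {\<omega> \<in> space M. N t \<omega> = n \<and> integral {0..t} (\<lambda>\<tau>. f (N \<tau> \<omega>)) = 0}
    \<le> ((rate * t)\<^sup>2 + real L * (rate * t) ^ n) / real m"
proof -
  define h where "h = t / real m"
  have h: "0 < h" "real m * h = t" using t m by (auto simp: h_def)
  define X where "X i \<omega> = N (real (Suc i) * h) \<omega> - N (real i * h) \<omega>" for i \<omega>
  define B where "B i = {\<omega> \<in> space M. 2 \<le> X i \<omega>}" for i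
  define E where "E J = {\<omega> \<in> space M. \<forall>i<m. X i \<omega> = of_bool (i \<in> J)}" for J
  \<comment> \<open>The threshold is the Riemann error bound \<open>2 * K * h * real n\<close> with
    the mesh \<open>h\<close> divided out.\<close>
  define F where "F = {J. J \<subseteq> {..<m} \<and> card J = n \<and> \<bar>\<Sum>i<m. f (card (J \<inter> {..<i}))\<bar> \<le> 2 * K * real n}"
  have finF: "finite F" unfolding F_def by (rule finite_subset[of _ "Pow {..<m}"]) auto
  have [measurable]: "X i \<in> measurable M (count_space UNIV)" for i
    unfolding X_def using h by (intro measurable_increment) auto
  have B_sets: "B i \<in> events" for i unfolding B_def by measurable
  have E_sets: "E J \<in> events" for J unfolding E_def by measurable
  have "{\<omega> \<in> space M. N t \<omega> = n \<and> integral {0..t} (\<lambda>\<tau>. f (N \<tau> \<omega>)) = 0}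
      \<subseteq> (\<Union>i<m. B i) \<union> (\<Union>J\<in>F. E J)"
  proof safe
    fix \<omega> assume \<omega>: "\<omega> \<in> space M" and n: "n = N t \<omega>"
      and zero: "integral {0..t} (\<lambda>\<tau>. f (N \<tau> \<omega>)) = 0" and nE: "\<omega> \<notin> (\<Union>J\<in>F. E J)"
    show "\<omega> \<in> (\<Union>i<m. B i)"
    proof (rule ccontr)
      assume "\<omega> \<notin> (\<Union>i<m. B i)"
      then have le1: "X i \<omega> < 2" if "i < m" for i
        using \<omega> that by (auto simp: B_def not_le)
      \<comment> \<open>With at most one jump per cell, the increments are exactly the indicator of
        this set.\<close>
      define J where "J = {i. i < m \<and> X i \<omega> = 1}"
      have XJ: "X i \<omega> = of_bool (i \<in> J)" if "i < m" for i
        using le1[OF that] that by (auto simp: J_def)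
      have count: "N (real i * h) \<omega> = card (J \<inter> {..<i})" if "i \<le> m" for i
        using configuration_count[OF \<omega> less_imp_le[OF h(1)] _ that] XJ by (simp add: X_def)
      have J: "J \<subseteq> {..<m}" by (auto simp: J_def)
      have "card J = n"
        using count[of m] J n by (simp add: h Int_absorb2)
      moreover have "\<bar>\<Sum>i<m. f (card (J \<inter> {..<i}))\<bar> \<le> 2 * K * real n"
      proof -
        have "h * \<bar>\<Sum>i<m. f (N (real i * h) \<omega>)\<bar> \<le> 2 * K * h * real n"
          using monotone_clock_riemann_error[OF mono_on_path[OF \<omega>], of f K h m] bound h
            N_zero[OF \<omega>] zero n
          by (simp add: abs_mult)
        then have "h * \<bar>\<Sum>i<m. f (N (real i * h) \<omega>)\<bar> \<le> h * (2 * K * real n)"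
          by (simp only: mult_ac)
        then have "\<bar>\<Sum>i<m. f (N (real i * h) \<omega>)\<bar> \<le> 2 * K * real n"
          using h(1) by (rule mult_left_le_imp_le)
        then show ?thesis by (simp add: count)
      qed
      ultimately have "J \<in> F" using J by (simp add: F_def)
      moreover have "\<omega> \<in> E J" using \<omega> XJ by (simp add: E_def)
      ultimately show False using nE by blast
    qed
  qed
  then have "prob {\<omega> \<in> space M. N t \<omega> = n \<and> integral {0..t} (\<lambda>\<tau>. f (N \<tau> \<omega>)) = 0}
      \<le> prob ((\<Union>i<m. B i) \<union> (\<Union>J\<in>F. E J))"
    using B_sets E_sets finF by (intro finite_measure_mono sets.Un sets.finite_UN) auto
  also have "\<dots> \<le> prob (\<Union>i<m. B i) + prob (\<Union>J\<in>F. E J)"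
    using B_sets E_sets finF by (intro measure_Un_le sets.finite_UN) auto
  also have "\<dots> \<le> (\<Sum>i<m. prob (B i)) + (\<Sum>J\<in>F. prob (E J))"
    using B_sets E_sets finF by (intro add_mono finite_measure_subadditive_finite) auto
  also have "\<dots> \<le> (\<Sum>i<m. (rate * h)\<^sup>2) + (\<Sum>J\<in>F. (rate * h) ^ n)"
  proof (intro add_mono sum_mono)
    fix i
    show "prob (B i) \<le> (rate * h)\<^sup>2"
      using prob_increment_ge_2[OF rate, of "real i * h" "real (Suc i) * h"] h
      by (simp add: B_def X_def algebra_simps)
  next
    fix J assume "J \<in> F"
    then have "J \<subseteq> {..<m}" "card J = n" by (auto simp: F_def)
    then show "prob (E J) \<le> (rate * h) ^ n"
      using prob_configuration[OF rate h(1) m, of J] by (simp add: E_def X_def)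
  qed
  also have "\<dots> = real m * (rate * h)\<^sup>2 + real (card F) * (rate * h) ^ n" by simp
  also have "\<dots> \<le> real m * (rate * h)\<^sup>2 + real (L * m ^ (n - 1)) * (rate * h) ^ n"
    using card_near_zero_configurations[OF k, where f = f and C = "2 * K * real n" and m = m] ne rate h
    by (intro add_left_mono mult_right_mono of_nat_mono) (auto simp: F_def L_def)
  also have "\<dots> = ((rate * t)\<^sup>2 + real L * (rate * t) ^ n) / real m"
  proof -
    \<comment> \<open>Since \<open>k < n\<close> gives \<open>0 < n\<close>, the truncated
      \<open>n - 1\<close> is a true predecessor and exactly one factor \<open>1 / m\<close>
      survives.\<close>
    have "real m ^ n = real m * real m ^ (n - 1)" using k by (cases n) auto
    then show ?thesis
      using m by (simp add: h_def power_divide add_divide_distrib power2_eq_square)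
  qed
  finally show ?thesis .
qed

text \<open>The event is fixed while the number of cells in the preceding bound is free; letting it
  grow forces probability 0.\<close>

lemma AE_clock_integral_nonzero:
  fixes f :: "nat \<Rightarrow> real"
  assumes rate: "0 < rate" and t: "0 < t" and bound: "\<And>i. \<bar>f i\<bar> \<le> K"
    and k: "k < n" and ne: "f k \<noteq> f (Suc k)"
  shows "AE \<omega> in M. \<not> (N t \<omega> = n \<and> integral {0..t} (\<lambda>\<tau>. f (N \<tau> \<omega>)) = 0)"
proof -
  define Z where "Z = {\<omega> \<in> space M. N t \<omega> = n \<and> integral {0..t} (\<lambda>\<tau>. f (N \<tau> \<omega>)) = 0}"
  have [measurable]: "(\<lambda>\<omega>. integral {0..t} (\<lambda>\<tau>. f (N \<tau> \<omega>))) \<in> borel_measurable M"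
    using measurable_clock_integral[of "\<lambda>k _. f k" K t] bound t by simp
  have [measurable]: "N t \<in> measurable M (count_space UNIV)"
    using t by (intro measurable_N) simp
  have Z: "Z \<in> events" unfolding Z_def by measurable
  define c where "c = (rate * t)\<^sup>2
    + real (Suc (nat \<lfloor>2 * (2 * K * real n) / \<bar>f (Suc k) - f k\<bar>\<rfloor>)) * (rate * t) ^ n"
  have "prob Z \<le> c * inverse (real (Suc m))" for m
    using clock_integral_zero_bound[OF rate t bound k ne, of "Suc m"]
    unfolding Z_def c_def divide_inverse by blast
  moreover have "(\<lambda>m. c * inverse (real (Suc m))) \<longlonglongrightarrow> 0"
    using tendsto_mult_right_zero LIMSEQ_inverse_real_of_nat by blast
  ultimately have "prob Z \<le> 0"
    by (intro LIMSEQ_le_const) auto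
  then have "prob Z = 0" by (simp add: measure_le_0_iff)
  then have "AE \<omega> in M. \<omega> \<notin> Z" using Z by (simp add: prob_eq_0)
  then show ?thesis by (rule AE_mp) (auto simp: Z_def)
qed

end

section \<open>Directions, headings and the position\<close>

lemma norm_dir: "norm (dir j) = 1"
  by (simp add: dir_def norm_Pair)

text \<open>Cosine vanishes exactly at the odd multiples of \<open>pi / 2\<close>, and sine at the
  even ones; so the parity of the index alone decides the axis of motion.\<close>

lemma fst_dir_eq_0_iff: "fst (dir j) = 0 \<longleftrightarrow> odd j"
proof -
  have "pi * of_int j / 2 = of_int i * (pi / 2) \<longleftrightarrow> j = i" for i by auto
  then show ?thesis by (simp add: dir_def cos_zero_iff_int)
qed

lemma snd_dir_eq_0_iff: "snd (dir j) = 0 \<longleftrightarrow> even j"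
proof -
  have "pi * of_int j / 2 = of_int i * (pi / 2) \<longleftrightarrow> j = i" for i by auto
  then show ?thesis by (simp add: dir_def sin_zero_iff_int)
qed

text \<open>\<open>S_region r\<close> is the ball of the 1-norm, which agrees with the Euclidean
  norm on the axes.\<close>

lemma Q_regionI:
  assumes "norm v \<le> r" and "fst v = 0 \<or> snd v = 0"
  shows "v \<in> Q_region r"
  using assms by (cases v) (auto simp: Q_region_def S_region_def norm_Pair)

context orthogonal_motion
begin

text \<open>The direction index indexed by events rather than by time, which separates the turns
  from the jump times. It is left unreduced modulo 4, as \<open>dir\<close> is periodic.\<close>

definition heading :: "nat \<Rightarrow> 'a \<Rightarrow> int" where
  "heading k \<omega> = start \<omega> + (\<Sum>i<k. turn i \<omega>)"

lemma position_eq: "position c N start turn t \<omega> = c *\<^sub>R integral {0..t} (\<lambda>\<tau>. dir (heading (N \<tau> \<omega>) \<omega>))"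
  by (simp add: position_def direction_def heading_def)

lemma heading_Suc: "heading (Suc k) \<omega> = heading k \<omega> + turn k \<omega>"
  by (simp add: heading_def)

lemma measurable_heading: "heading k \<in> measurable M (count_space UNIV)"
proof (induction k)
  case 0
  then show ?case using measurable_start by (simp add: heading_def[abs_def])
next
  case (Suc k)
  have "(\<lambda>\<omega>. j + turn k \<omega>) \<in> measurable M (count_space UNIV)" for j
    using measurable_turn by (rule measurable_compose) simp
  then have "(\<lambda>\<omega>. heading k \<omega> + turn k \<omega>) \<in> measurable M (count_space UNIV)"
    using Suc by (rule measurable_compose_countable)
  then show ?case by (simp add: heading_Suc[abs_def])
qed

lemma measurable_position:
  assumes "0 \<le> t"
  shows "position c N start turn t \<in> borel_measurable M"
proof -
  have "(\<lambda>\<omega>. dir (heading k \<omega>)) \<in> borel_measurable M" for k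
    using measurable_heading by (rule measurable_compose) simp
  then have "(\<lambda>\<omega>. integral {0..t} (\<lambda>\<tau>. dir (heading (N \<tau> \<omega>) \<omega>))) \<in> borel_measurable M"
    using assms by (intro measurable_clock_integral[of "\<lambda>k \<omega>. dir (heading k \<omega>)" 1]) (auto simp: norm_dir)
  then show ?thesis
    unfolding position_eq[abs_def] by (rule borel_measurable_scaleR[OF borel_measurable_const])
qed

lemma direction_integrable:
  assumes "\<omega> \<in> space M"
  shows "(\<lambda>\<tau>. dir (heading (N \<tau> \<omega>) \<omega>)) integrable_on {0..t}"
  by (rule monotone_clock_integrable[of _ _ _ "\<lambda>k. dir (heading k \<omega>)" 1])
    (auto simp: norm_dir intro: mono_on_subset[OF mono_on_path[OF assms]])

lemma fst_position:
  assumes "\<omega> \<in> space M"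
  shows "fst (position c N start turn t \<omega>) = c * integral {0..t} (\<lambda>\<tau>. fst (dir (heading (N \<tau> \<omega>) \<omega>)))"
  using integral_linear[OF direction_integrable[OF assms] bounded_linear_fst, of t]
  by (simp add: position_eq comp_def)

lemma snd_position:
  assumes "\<omega> \<in> space M"
  shows "snd (position c N start turn t \<omega>) = c * integral {0..t} (\<lambda>\<tau>. snd (dir (heading (N \<tau> \<omega>) \<omega>)))"
  using integral_linear[OF direction_integrable[OF assms] bounded_linear_snd, of t]
  by (simp add: position_eq comp_def)

lemma norm_position_le:
  assumes "\<omega> \<in> space M" "0 \<le> c" "0 \<le> t"
  shows "norm (position c N start turn t \<omega>) \<le> c * t"
proof -
  have "norm (integral {0..t} (\<lambda>\<tau>. dir (heading (N \<tau> \<omega>) \<omega>))) \<le> integral {0..t} (\<lambda>\<tau>. 1 :: real)"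
    using direction_integrable[OF assms(1)]
    by (intro Henstock_Kurzweil_Integration.integral_norm_bound_integral) (auto simp: norm_dir)
  then show ?thesis
    using assms by (simp add: position_eq mult_left_mono)
qed

text \<open>A reflection adds 2 to the heading, so the parity stays that of \<open>start\<close> up
  to time \<open>t\<close> and one coordinate of the velocity is identically 0.\<close>

lemma only_reflections_position_in_Q_region:
  assumes \<omega>: "\<omega> \<in> space M" and "0 \<le> c" "0 \<le> t" and refl: "\<And>k. k < N t \<omega> \<Longrightarrow> turn k \<omega> = 2"
  shows "position c N start turn t \<omega> \<in> Q_region (c * t)"
proof (rule Q_regionI)
  show "norm (position c N start turn t \<omega>) \<le> c * t"
    using assms by (intro norm_position_le)
  have parity: "even (heading k \<omega>) \<longleftrightarrow> even (start \<omega>)" if "k \<le> N t \<omega>" for k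
    using that by (induction k) (auto simp: heading_Suc refl, auto simp: heading_def)
  have parity': "even (heading (N \<tau> \<omega>) \<omega>) \<longleftrightarrow> even (start \<omega>)" if "\<tau> \<in> {0..t}" for \<tau>
    using that N_mono[OF \<omega>, of \<tau> t] by (intro parity) auto
  show "fst (position c N start turn t \<omega>) = 0 \<or> snd (position c N start turn t \<omega>) = 0"
  proof (cases "even (start \<omega>)")
    case True
    then have "integral {0..t} (\<lambda>\<tau>. snd (dir (heading (N \<tau> \<omega>) \<omega>))) = integral {0..t} (\<lambda>\<tau>. 0)"
      by (intro Henstock_Kurzweil_Integration.integral_cong) (simp add: snd_dir_eq_0_iff parity')
    then show ?thesis by (simp add: snd_position[OF \<omega>])
  next
    case False
    then have "integral {0..t} (\<lambda>\<tau>. fst (dir (heading (N \<tau> \<omega>) \<omega>))) = integral {0..t} (\<lambda>\<tau>. 0)"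
      by (intro Henstock_Kurzweil_Integration.integral_cong) (simp add: fst_dir_eq_0_iff parity')
    then show ?thesis by (simp add: fst_position[OF \<omega>])
  qed
qed

section \<open>Orthogonal turns make both coordinates nonzero\<close>

text \<open>The three given probabilities add up to 1. This is what makes a turn other than 2 almost
  surely odd.\<close>

lemma AE_turn_values: "AE \<omega> in M. \<forall>k. turn k \<omega> \<in> {1, - 1, 2}"
proof (subst AE_all_countable, rule allI)
  fix k
  note [measurable] = measurable_turn[of k]
  define E where "E j = {\<omega> \<in> space M. turn k \<omega> = j}" for j
  have [measurable]: "E j \<in> events" for j unfolding E_def by measurable
  have "prob (E 1 \<union> E (- 1) \<union> E 2) = prob (E 1) + prob (E (- 1)) + prob (E 2)"
    by (subst finite_measure_Union; (subst finite_measure_Union)?) (auto simp: E_def)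
  also have "\<dots> = 1"
    unfolding E_def turn_counterclockwise turn_clockwise turn_reflection by simp
  finally have "AE \<omega> in M. \<omega> \<in> E 1 \<union> E (- 1) \<union> E 2"
    by (subst (asm) prob_eq_1) auto
  then show "AE \<omega> in M. turn k \<omega> \<in> {1, - 1, 2}"
    by (rule AE_mp) (auto simp: E_def)
qed

text \<open>The clock result concerns a deterministic integrand. The exceptional null sets of all
  integer lists are united, a countable union, and the random headings are then one of these
  lists.\<close>

lemma AE_headings_integral_nonzero:
  assumes "0 < rate" "0 < t" and \<phi>: "\<And>j. \<bar>\<phi> j\<bar> \<le> K"
  shows "AE \<omega> in M. \<forall>k. k < N t \<omega> \<longrightarrow> \<phi> (heading k \<omega>) \<noteq> \<phi> (heading (Suc k) \<omega>)
    \<longrightarrow> integral {0..t} (\<lambda>\<tau>. \<phi> (heading (N \<tau> \<omega>) \<omega>)) \<noteq> (0 :: real)"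
proof -
  \<comment> \<open>Entries past the end of \<open>l\<close> are unspecified but still integers, so
    \<open>\<phi> (l ! i)\<close> obeys the bound \<open>K\<close> at every index.\<close>
  have "AE \<omega> in M. \<forall>(l :: int list) n k. k < n \<and> \<phi> (l ! k) \<noteq> \<phi> (l ! Suc k) \<longrightarrow>
      \<not> (N t \<omega> = n \<and> integral {0..t} (\<lambda>\<tau>. \<phi> (l ! N \<tau> \<omega>)) = 0)"
    using AE_clock_integral_nonzero[OF assms(1,2) \<phi>]
    by (intro AE_all_countable[THEN iffD2] allI) (auto simp: AE_conj_iff)
  then show ?thesis
  proof (rule AE_mp, intro AE_I2 impI allI)
    fix \<omega> k
    assume \<omega>: "\<omega> \<in> space M" and k: "k < N t \<omega>" and ne: "\<phi> (heading k \<omega>) \<noteq> \<phi> (heading (Suc k) \<omega>)"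
      and *: "\<forall>(l :: int list) n k. k < n \<and> \<phi> (l ! k) \<noteq> \<phi> (l ! Suc k) \<longrightarrow>
        \<not> (N t \<omega> = n \<and> integral {0..t} (\<lambda>\<tau>. \<phi> (l ! N \<tau> \<omega>)) = 0)"
    \<comment> \<open>headings up to \<open>N t\<close> as a list, so that only countably many deterministic cases arise\<close>
    define l where "l = map (\<lambda>i. heading i \<omega>) [0..<Suc (N t \<omega>)]"
    have l: "l ! i = heading i \<omega>" if "i \<le> N t \<omega>" for i
      using that by (simp add: l_def del: upt_Suc)
    have "integral {0..t} (\<lambda>\<tau>. \<phi> (l ! N \<tau> \<omega>)) \<noteq> 0"
      using *[rule_format, of k "N t \<omega>" l] k ne by (simp add: l)
    also have "integral {0..t} (\<lambda>\<tau>. \<phi> (l ! N \<tau> \<omega>)) = integral {0..t} (\<lambda>\<tau>. \<phi> (heading (N \<tau> \<omega>) \<omega>))"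
      using N_mono[OF \<omega>, of _ t] by (intro Henstock_Kurzweil_Integration.integral_cong) (simp add: l)
    finally show "integral {0..t} (\<lambda>\<tau>. \<phi> (heading (N \<tau> \<omega>) \<omega>)) \<noteq> 0" .
  qed
qed

text \<open>An odd turn flips the parity of the heading, so each coordinate of \<open>dir\<close>
  vanishes on exactly one side of it and therefore changes; almost surely neither coordinate
  integral is then 0.\<close>

lemma AE_position_in_Q_region_only_reflections:
  assumes "0 < rate" "0 < t" "0 < c"
  shows "AE \<omega> in M. position c N start turn t \<omega> \<in> Q_region (c * t) \<longrightarrow> (\<forall>k<N t \<omega>. turn k \<omega> = 2)"
proof -
  note nonzero = AE_headings_integral_nonzero[OF assms(1,2), of _ 1]
  have "\<bar>fst (dir j)\<bar> \<le> 1" "\<bar>snd (dir j)\<bar> \<le> 1" for j by (simp_all add: dir_def)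
  note nonzero = nonzero[of "\<lambda>j. fst (dir j)", OF this(1)] nonzero[of "\<lambda>j. snd (dir j)", OF this(2)]
  show ?thesis
    using AE_turn_values nonzero AE_space
  proof eventually_elim
    case (elim \<omega>)
    show ?case
    proof (intro impI allI, rule ccontr)
      fix k assume Q: "position c N start turn t \<omega> \<in> Q_region (c * t)"
        and k: "k < N t \<omega>" and "turn k \<omega> \<noteq> 2"
      then have "odd (turn k \<omega>)" using elim(1)[rule_format, of k] by auto
      then have "even (heading k \<omega>) \<noteq> even (heading (Suc k) \<omega>)"
        by (simp add: heading_Suc)
      then have "fst (dir (heading k \<omega>)) \<noteq> fst (dir (heading (Suc k) \<omega>))"
        "snd (dir (heading k \<omega>)) \<noteq> snd (dir (heading (Suc k) \<omega>))"
        using fst_dir_eq_0_iff snd_dir_eq_0_iff by metis+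
      then have "fst (position c N start turn t \<omega>) \<noteq> 0" "snd (position c N start turn t \<omega>) \<noteq> 0"
        using elim k \<open>0 < c\<close> by (auto simp: fst_position snd_position)
      then show False using Q by (auto simp: Q_region_def)
    qed
  qed
qed

section \<open>Probability of seeing only reflections, and conclusion\<close>

text \<open>The event involves only the clock and the first \<open>n\<close> turns, finitely many
  sources, so mutual independence turns it into a product.\<close>

lemma prob_first_turns_reflections:
  assumes "0 \<le> t"
  shows "prob {\<omega> \<in> space M. N t \<omega> = n \<and> (\<forall>k<n. turn k \<omega> = 2)}
    = prob {\<omega> \<in> space M. N t \<omega> = n} * (1 - p - q) ^ n"
proof -
  define A where "A s = (case s of Clock \<Rightarrow> N t -` {n} \<inter> space M | Start \<Rightarrow> {}
    | Turn k \<Rightarrow> turn k -` {2} \<inter> space M)" for s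
  let ?J = "insert Clock (Turn ` {..<n})"
  have "prob (\<Inter>s\<in>?J. A s) = (\<Prod>s\<in>?J. prob (A s))"
    using assms by (intro indep_setsD[OF sources_indep]) (auto simp: A_def)
  also have "(\<Inter>s\<in>?J. A s) = {\<omega> \<in> space M. N t \<omega> = n \<and> (\<forall>k<n. turn k \<omega> = 2)}"
    by (auto simp: A_def)
  also have "(\<Prod>s\<in>?J. prob (A s)) = prob (A Clock) * (\<Prod>s\<in>Turn ` {..<n}. prob (A s))"
    by (subst prod.insert) auto
  also have "(\<Prod>s\<in>Turn ` {..<n}. prob (A s)) = (\<Prod>k<n. prob (A (Turn k)))"
    by (subst prod.reindex) (auto simp: inj_on_def)
  also have "\<dots> = (1 - p - q) ^ n"
  proof -
    have "A (Turn k) = {\<omega> \<in> space M. turn k \<omega> = 2}" for k by (auto simp: A_def)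
    then show ?thesis by (simp add: turn_reflection)
  qed
  also have "A Clock = {\<omega> \<in> space M. N t \<omega> = n}" by (auto simp: A_def)
  finally show ?thesis .
qed

text \<open>Splitting by the value of \<open>N t\<close> gives the Poisson generating function at
  \<open>1 - p - q\<close>.\<close>

lemma prob_only_reflections:
  assumes "0 < rate" "0 < t"
  shows "prob {\<omega> \<in> space M. \<forall>k<N t \<omega>. turn k \<omega> = 2} = exp (- rate * (p + q) * t)"
proof -
  define E where "E n = {\<omega> \<in> space M. N t \<omega> = n \<and> (\<forall>k<n. turn k \<omega> = 2)}" for n
  have [measurable]: "N t \<in> measurable M (count_space UNIV)"
    using assms by (intro measurable_N) simp
  note [measurable] = measurable_turn
  have "E n \<in> events" for n unfolding E_def by measurable
  then have "(\<lambda>n. prob (E n)) sums prob (\<Union>n. E n)"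
    by (intro finite_measure_UNION) (auto simp: disjoint_family_on_def E_def)
  \<comment> \<open>Terms of the exponential series; \<open>0 ^ 0 = 1\<close> gives the right term
    \<open>n = 0\<close> when \<open>p + q = 1\<close>.\<close>
  moreover have "prob (E n) = exp (- (rate * t)) * ((rate * t * (1 - p - q)) ^ n /\<^sub>R fact n)" for n
    using assms by (simp add: E_def prob_first_turns_reflections prob_N power_mult_distrib
        divide_inverse mult_ac)
  ultimately have "(\<lambda>n. exp (- (rate * t)) * ((rate * t * (1 - p - q)) ^ n /\<^sub>R fact n)) sums prob (\<Union>n. E n)"
    by simp
  then have "prob (\<Union>n. E n) = exp (- (rate * t)) * exp (rate * t * (1 - p - q))"
    using sums_mult[OF exp_converges] by (rule sums_unique2)
  also have "\<dots> = exp (- rate * (p + q) * t)"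
    by (simp add: exp_add[symmetric] algebra_simps)
  also have "(\<Union>n. E n) = {\<omega> \<in> space M. \<forall>k<N t \<omega>. turn k \<omega> = 2}"
    by (auto simp: E_def)
  finally show ?thesis .
qed

lemma prob_position_in_Q_region:
  assumes "0 < rate" "0 < t" "0 < c"
  shows "prob {\<omega> \<in> space M. position c N start turn t \<omega> \<in> Q_region (c * t)} = exp (- rate * (p + q) * t)"
proof -
  let ?P = "position c N start turn t"
  have P: "?P \<in> borel_measurable M" using assms by (intro measurable_position) simp
  have [measurable]: "(\<lambda>\<omega>. fst (?P \<omega>)) \<in> borel_measurable M" "(\<lambda>\<omega>. snd (?P \<omega>)) \<in> borel_measurable M"
    using P by (rule measurable_compose, intro borel_measurable_continuous_onI continuous_intros)+
  have [measurable]: "N t \<in> measurable M (count_space UNIV)"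
    using assms by (intro measurable_N) simp
  note [measurable] = measurable_turn
  have "prob {\<omega> \<in> space M. ?P \<omega> \<in> Q_region (c * t)} = prob {\<omega> \<in> space M. \<forall>k<N t \<omega>. turn k \<omega> = 2}"
  proof (rule measure_eq_AE)
    \<comment> \<open>Only the direction from \<open>Q_region\<close> to reflections is almost sure;
      the converse holds for every outcome.\<close>
    show "AE \<omega> in M. \<omega> \<in> {\<omega> \<in> space M. ?P \<omega> \<in> Q_region (c * t)}
        \<longleftrightarrow> \<omega> \<in> {\<omega> \<in> space M. \<forall>k<N t \<omega>. turn k \<omega> = 2}"
      using AE_position_in_Q_region_only_reflections[OF assms]
      by (rule AE_mp) (intro AE_I2, use assms in \<open>auto intro: only_reflections_position_in_Q_region\<close>)
    have "{\<omega> \<in> space M. \<bar>fst (?P \<omega>) + snd (?P \<omega>)\<bar> \<le> c * t \<and> \<bar>fst (?P \<omega>) - snd (?P \<omega>)\<bar> \<le> c * t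
        \<and> (fst (?P \<omega>) = 0 \<or> snd (?P \<omega>) = 0)} \<in> events"
      by measurable
    then show "{\<omega> \<in> space M. ?P \<omega> \<in> Q_region (c * t)} \<in> events"
      by (simp add: Q_region_def S_region_def case_prod_unfold)
    show "{\<omega> \<in> space M. \<forall>k<N t \<omega>. turn k \<omega> = 2} \<in> events"
      by measurable
  qed
  then show ?thesis using prob_only_reflections assms by simp
qed

end

theorem mainTheorem4:
  fixes M :: "'a measure" and rate c p q t :: real
    and N :: "real \<Rightarrow> 'a \<Rightarrow> nat" and start :: "'a \<Rightarrow> int" and turn :: "nat \<Rightarrow> 'a \<Rightarrow> int"
  assumes "0 < rate" and "0 < c" and "0 \<le> p" and "0 \<le> q" and "p + q \<le> 1"
    and "orthogonal_motion M rate N p q start turn"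
    and "0 < t"
  shows "measure M {\<omega> \<in> space M. position c N start turn t \<omega> \<in> Q_region (c * t)}
    = exp (- rate * (p + q) * t)"
  using assms by (intro orthogonal_motion.prob_position_in_Q_region)

end
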